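(* For any positive integer $n$, $$\sum_{\pi\in\mathcal B_n}(-1)^{\mathrm{inv}(|\pi|)}t^{\mathrm{des}_B(\pi)}q^{\mathrm{maj}_B(\pi)} = \left(1+(-1)^{n-1}tq^{n-1}\right)\prod_{i=0}^{n-2}\left(1-tq^i\right).$$
   Context: $\mathcal B_n$ is the group of signed permutations: words $\pi=\pi_1\cdots\pi_n$ with $\pi_i\in\{\pm1,\dots,\pm n\}$ such that $|\pi|:=|\pi_1|\cdots|\pi_n|$ is a permutation of $\{1,\dots,n\}$. $\mathrm{inv}(|\pi|)=|\{(i,j):i<j,\ |\pi_i|>|\pi_j|\}|$. With respect to the natural order of integers, $\mathrm{Des}_B(\pi)=\{i:0\le i\le n-1,\ \pi_i>\pi_{i+1}\}$ with $\pi_0:=0$; $\mathrm{des}_B(\pi)=|\mathrm{Des}_B(\pi)|$; $\mathrm{maj}_B(\pi)=\sum_{i\in\mathrm{Des}_B(\pi)}i$. $t,q$ are commuting indeterminates; an empty product equals $1$. *)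

theory Defs
  imports
    "HOL-Combinatorics.Multiset_Permutations"
    "HOL-Computational_Algebra.Polynomial"
begin

definition signed_perms :: "nat \<Rightarrow> int list set" where
  "signed_perms n = {w. map abs w \<in> permutations_of_set {1..int n}}"

text \<open>
  Letters are indexed from 1, as in \<open>\<pi>\<^sub>1 \<dots> \<pi>\<^sub>n\<close>, and prepending 0 implements the
  convention \<open>\<pi>\<^sub>0 = 0\<close>.
\<close>

definition letter :: "int list \<Rightarrow> nat \<Rightarrow> int" where
  "letter w i = (0 # w) ! i"

definition inv_word :: "int list \<Rightarrow> nat" where
  "inv_word w =
     card {(i, j). 1 \<le> i \<and> i < j \<and> j \<le> length w \<and> letter w i > letter w j}"

definition Des_B :: "int list \<Rightarrow> nat set" where
  "Des_B w = {i. i < length w \<and> letter w i > letter w (i + 1)}"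

definition des_B :: "int list \<Rightarrow> nat" where
  "des_B w = card (Des_B w)"

definition maj_B :: "int list \<Rightarrow> nat" where
  "maj_B w = (\<Sum>i\<in>Des_B w. i)"

text \<open>
  The polynomial ring \<open>\<int>[t, q]\<close> is represented as \<open>\<int>[q][t]\<close>: \<open>t\<close> is the outer
  indeterminate, and \<open>q\<close> is the indeterminate of the coefficient ring, embedded as a constant.
\<close>

definition var_t :: "int poly poly" where
  "var_t = [:0, 1:]"

definition var_q :: "int poly poly" where
  "var_q = [:[:0, 1:]:]"

text \<open>A sum over \<open>signed_perms n\<close> is a genuine finite sum.\<close>

lemma length_signed_perms: "w \<in> signed_perms n \<Longrightarrow> length w = n"
  unfolding signed_perms_def using length_finite_permutations_of_set[of "map abs w" "{1..int n}"]
  by simp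

lemma finite_signed_perms: "finite (signed_perms n)"
proof (rule finite_subset)
  show "signed_perms n \<subseteq> {w. set w \<subseteq> {- int n..int n} \<and> length w = n}"
  proof
    fix w assume w: "w \<in> signed_perms n"
    have abs_set: "abs ` set w = {1..int n}"
      using permutations_of_setD(1)[of "map abs w" "{1..int n}"] w
      unfolding signed_perms_def by simp
    have "x \<in> {- int n..int n}" if "x \<in> set w" for x
    proof -
      have "\<bar>x\<bar> \<in> {1..int n}"
        using imageI[OF that, of abs] unfolding abs_set .
      then show ?thesis by (simp add: abs_le_iff)
    qed
    then show "w \<in> {w. set w \<subseteq> {- int n..int n} \<and> length w = n}"
      using length_signed_perms[OF w] by blast
  qed
  show "finite {w. set w \<subseteq> {- int n..int n} \<and> length w = n}"
    by (rule finite_lists_length_eq) simp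
qed

end

theory Submission
  imports Defs
begin

text \<open>
  The identity holds for arbitrary descent weights: if a descent at position \<open>i\<close> is weighted by
  a free parameter \<open>x\<^sub>i\<close> instead of \<open>t q\<^sup>i\<close>, the signed sum \<open>F\<^sub>n(x\<^sub>0, \<dots>, x\<^sub>n\<^sub>-\<^sub>1)\<close> is
  \<open>(1 - x\<^sub>0) \<cdots> (1 - x\<^sub>n\<^sub>-\<^sub>2) (1 \<plusminus> x\<^sub>n\<^sub>-\<^sub>1)\<close>, with \<open>+\<close> exactly when \<open>n\<close> is odd. This follows from
  the recursion
  \<open>F\<^sub>n(x\<^sub>0, x\<^sub>1, x\<^sub>2, \<dots>) = (1 - x\<^sub>0) (1 - x\<^sub>1) F\<^sub>n\<^sub>-\<^sub>2(x\<^sub>2, x\<^sub>3, \<dots>)\<close>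
  (lemma \<open>sum_signed_words_step\<close>) and the values \<open>F\<^sub>0 = 1\<close> and \<open>F\<^sub>1 = 1 + x\<^sub>0\<close>. Free weights are
  what makes the recursion possible, since removing two letters shifts the positions.

  For the recursion let \<open>a < b\<close> be the two smallest absolute values. Interchanging them changes
  the sign of the permutation of absolute values, so any involution on words that does this and
  keeps all descents makes the words it acts on cancel. Two such involutions are used.

  \<^item> Interchange \<open>a\<close> and \<open>b\<close>, leaving the signs in their places. No other absolute value lies
    between \<open>a\<close> and \<open>b\<close>, so the only comparison that can change is the one between the two
    letters themselves, and it does so only if they have the same sign. Hence all words cancel in
    which these letters are not neighbours of the same sign (\<open>sum_no_like_pair\<close>).

  \<^item> Interchange \<open>a\<close> and \<open>b\<close> and negate both: \<open>a b\<close> becomes \<open>-b -a\<close>, and \<open>b a\<close> becomes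
    \<open>-a -b\<close>. The order within the pair is kept, and how a further letter compares with the
    pair depends only on the sign of that letter. Only the comparison with \<open>\<pi>\<^sub>0 = 0\<close> could
    change, so all words cancel in which the pair stands anywhere but at the beginning
    (\<open>sum_later_like_pair\<close>).

  The remaining words start with \<open>a b\<close>, \<open>b a\<close>, \<open>-a -b\<close> or \<open>-b -a\<close>, which contribute
  \<open>1 - x\<^sub>1 + x\<^sub>0 x\<^sub>1 - x\<^sub>0 = (1 - x\<^sub>0) (1 - x\<^sub>1)\<close>. The rest of the word sees the initial pair
  just as it would see the letter \<open>\<pi>\<^sub>0 = 0\<close>, so it contributes the same sum for the remaining
  alphabet (\<open>sum_initial_like_pair\<close>).
\<close>

section \<open>Signed words over an alphabet\<close>

text \<open>
  Alphabets are arbitrary sets, so that deleting two letters needs no renumbering of the others.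
\<close>

definition signed_words :: "int set \<Rightarrow> int list set" where
  "signed_words A = {w. map abs w \<in> permutations_of_set A}"

definition inv_sign :: "int list \<Rightarrow> 'a::comm_ring_1" where
  "inv_sign w = (- 1) ^ inv_word (map abs w)"

definition descent_weight :: "(nat \<Rightarrow> 'a::comm_ring_1) \<Rightarrow> int list \<Rightarrow> 'a" where
  "descent_weight x w =
     (\<Prod>i<length w. if letter w i > letter w (Suc i) then x i else 1)"

lemma signed_words_iff: "w \<in> signed_words A \<longleftrightarrow> abs ` set w = A \<and> distinct (map abs w)"
  by (simp add: signed_words_def permutations_of_set_def)

lemma finite_signed_words: "finite A \<Longrightarrow> finite (signed_words A)"
  unfolding signed_words_def permutations_of_set_def
proof (rule finite_subset)
  assume A: "finite A"
  show "finite {w. set w \<subseteq> A \<union> uminus ` A \<and> length w = card A}"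
    using A by (intro finite_lists_length_eq) auto
  show "{w. map abs w \<in> {xs. set xs = A \<and> distinct xs}}
      \<subseteq> {w. set w \<subseteq> A \<union> uminus ` A \<and> length w = card A}"
  proof safe
    fix w :: "int list" and y
    assume *: "A = set (map abs w)" "y \<in> set w" "y \<notin> uminus ` set (map abs w)"
    have "y = - \<bar>y\<bar> \<or> y = \<bar>y\<bar>" by arith
    moreover have "\<bar>y\<bar> \<in> set (map abs w)" using *(2) by simp
    ultimately show "y \<in> set (map abs w)" using *(3) by (metis imageI)
  next
    fix w :: "int list"
    assume "distinct (map abs w)"
    then show "length w = card (set (map abs w))"
      using distinct_card[of "map abs w"] by simp
  qed
qed

lemma letter_0 [simp]: "letter w 0 = 0"
  by (simp add: letter_def)

lemma letter_Suc [simp]: "letter w (Suc i) = w ! i"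
  by (simp add: letter_def)

lemma letter_Cons [simp]: "0 < i \<Longrightarrow> letter (y # w) (Suc i) = letter w i"
  by (simp add: letter_def)

lemma letter_map: "f 0 = 0 \<Longrightarrow> i \<le> length w \<Longrightarrow> letter (map f w) i = f (letter w i)"
  by (cases i) auto

text \<open>
  The hypothesis also covers the comparison of the first letter with \<open>\<pi>\<^sub>0 = 0\<close>, at \<open>i = 0\<close>.
\<close>

lemma descent_weight_map:
  assumes "f 0 = 0"
    and "\<And>i. i < length w \<Longrightarrow>
      f (letter w i) > f (letter w (Suc i)) \<longleftrightarrow> letter w i > letter w (Suc i)"
  shows "descent_weight x (map f w) = descent_weight x w"
  unfolding descent_weight_def length_map
proof (rule prod.cong)
  fix i assume "i \<in> {..<length w}"
  then have i: "i < length w" by simp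
  show "(if letter (map f w) (Suc i) < letter (map f w) i then x i else 1) =
        (if letter w (Suc i) < letter w i then x i else 1)"
    using assms(2)[OF i] i letter_map[of f, OF assms(1), of i w]
      letter_map[of f, OF assms(1), of "Suc i" w]
    by simp
qed simp

lemma abs_letter_eq_iff:
  assumes "w \<in> signed_words A" "0 < i" "i \<le> length w" "0 < j" "j \<le> length w"
  shows "\<bar>letter w i\<bar> = \<bar>letter w j\<bar> \<longleftrightarrow> i = j"
proof -
  obtain k l where kl: "i = Suc k" "j = Suc l"
    using assms(2,4) by (metis gr0_implies_Suc)
  have "distinct (map abs w)"
    using assms(1) by (simp add: signed_words_iff)
  then show ?thesis
    using nth_eq_iff_index_eq[of "map abs w" k l] assms(3,5) kl by auto
qed

lemma abs_letter_in:
  assumes "w \<in> signed_words A" "0 < i" "i \<le> length w"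
  shows "\<bar>letter w i\<bar> \<in> A"
proof -
  obtain k where k: "i = Suc k"
    using assms(2) by (metis gr0_implies_Suc)
  then have "w ! k \<in> set w" using assms(3) by simp
  then show ?thesis using assms(1) k by (auto simp: signed_words_iff)
qed

lemma ex_abs_letter:
  assumes "w \<in> signed_words A" "c \<in> A"
  obtains i where "0 < i" "i \<le> length w" "\<bar>letter w i\<bar> = c"
proof -
  obtain y where "y \<in> set w" "c = \<bar>y\<bar>"
    using assms by (auto simp: signed_words_iff)
  then obtain k where "k < length w" "\<bar>w ! k\<bar> = c"
    by (metis in_set_conv_nth)
  then show ?thesis using that[of "Suc k"] by simp
qed

section \<open>Exchanging the two smallest absolute values\<close>

locale two_smallest =
  fixes A :: "int set" and a b :: int
  assumes finite_A: "finite A" and aA: "a \<in> A" and bA: "b \<in> A"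
    and a_pos: "0 < a" and a_less_b: "a < b"
    and others: "\<And>z. z \<in> A \<Longrightarrow> z = a \<or> z = b \<or> b < z"
begin

definition exchange :: "int \<Rightarrow> int" where
  "exchange z = (if \<bar>z\<bar> = a then sgn z * b else if \<bar>z\<bar> = b then sgn z * a else z)"

definition neg_exchange :: "int \<Rightarrow> int" where
  "neg_exchange z = (if \<bar>z\<bar> = a then - sgn z * b else if \<bar>z\<bar> = b then - sgn z * a else z)"

text \<open>
  The exceptional configuration for the first involution: the two smallest letters, in some order
  and with a common sign. Exactly then does \<open>exchange\<close> reverse their comparison.
\<close>

abbreviation like_pair :: "int \<Rightarrow> int \<Rightarrow> bool" where
  "like_pair y z \<equiv> {\<bar>y\<bar>, \<bar>z\<bar>} = {a, b} \<and> sgn y = sgn z"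

lemma exchange_facts:
  "exchange 0 = 0" "exchange (exchange z) = z"
  "\<bar>exchange z\<bar> = exchange \<bar>z\<bar>" "sgn (exchange z) = sgn z"
  using a_pos a_less_b by (auto simp: exchange_def sgn_if abs_if)

lemma neg_exchange_facts:
  "neg_exchange 0 = 0" "neg_exchange (neg_exchange z) = z"
  "\<bar>neg_exchange z\<bar> = exchange \<bar>z\<bar>"
  using a_pos a_less_b by (auto simp: exchange_def neg_exchange_def sgn_if abs_if)

lemma exchange_in_pair: "{exchange u, exchange v} = {a, b} \<longleftrightarrow> {u, v} = {a, b}"
  using a_pos a_less_b by (auto simp: exchange_def doubleton_eq_iff sgn_if split: if_splits)

lemma exchange_values:
  "exchange a = b" "exchange b = a" "exchange (- a) = - b" "exchange (- b) = - a"
  "b < \<bar>z\<bar> \<Longrightarrow> exchange z = z"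
  using a_pos a_less_b by (auto simp: exchange_def)

lemma neg_exchange_values:
  "neg_exchange a = - b" "neg_exchange b = - a" "neg_exchange (- a) = b" "neg_exchange (- b) = a"
  "b < \<bar>z\<bar> \<Longrightarrow> neg_exchange z = z"
  using a_pos a_less_b by (auto simp: neg_exchange_def)

lemma letter_cases:
  assumes "\<bar>z\<bar> \<in> A"
  shows "z = a \<or> z = - a \<or> z = b \<or> z = - b \<or> b < z \<or> z < - b"
  using others[OF assms] by arith

lemma exchange_less_iff:
  assumes "y = 0 \<or> \<bar>y\<bar> \<in> A" "z = 0 \<or> \<bar>z\<bar> \<in> A" "\<not> like_pair y z"
  shows "exchange z < exchange y \<longleftrightarrow> z < y"
proof -
  have "y = 0 \<or> y = a \<or> y = - a \<or> y = b \<or> y = - b \<or> b < y \<or> y < - b"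
    "z = 0 \<or> z = a \<or> z = - a \<or> z = b \<or> z = - b \<or> b < z \<or> z < - b"
    using assms(1,2) letter_cases by auto
  then show ?thesis
    using assms(3) a_pos a_less_b
    by (elim disjE) (simp_all add: exchange_values exchange_facts insert_commute)
qed

lemma neg_exchange_less_iff:
  assumes "\<bar>y\<bar> \<in> A" "\<bar>z\<bar> \<in> A" "\<bar>y\<bar> \<noteq> \<bar>z\<bar>" "{\<bar>y\<bar>, \<bar>z\<bar>} = {a, b} \<Longrightarrow> sgn y = sgn z"
  shows "neg_exchange z < neg_exchange y \<longleftrightarrow> z < y"
  using letter_cases[OF assms(1)] letter_cases[OF assms(2)] assms(3,4) a_pos a_less_b
  by (elim disjE) (simp_all add: neg_exchange_values insert_commute)

lemma map_signed_words:
  assumes w: "w \<in> signed_words A" and f: "\<And>z. \<bar>f z\<bar> = exchange \<bar>z\<bar>"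
  shows "map f w \<in> signed_words A"
proof -
  have pos: "0 < z" if "z \<in> A" for z
    using others[OF that] a_pos a_less_b by auto
  have "exchange ` A = A"
  proof
    show sub: "exchange ` A \<subseteq> A"
      using aA bA pos by (auto simp: exchange_def sgn_if)
    show "A \<subseteq> exchange ` A"
    proof
      fix z assume "z \<in> A"
      then have "exchange z \<in> A" using sub by blast
      then show "z \<in> exchange ` A" by (metis exchange_facts(2) imageI)
    qed
  qed
  moreover have "inj exchange" by (metis exchange_facts(2) injI)
  ultimately have "set (map exchange u) = A \<and> distinct (map exchange u)"
    if "set u = A" "distinct u" for u
    using that by (simp add: distinct_map) (metis inj_on_subset subset_UNIV)
  moreover have "map abs (map f w) = map exchange (map abs w)"
    using f by simp
  ultimately show ?thesis
    using w by (simp only: signed_words_def permutations_of_set_def mem_Collect_eq)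
qed

text \<open>
  Since \<open>a\<close> and \<open>b\<close> are neighbours in the alphabet, interchanging them affects only one pair of
  positions, namely theirs. The two inversion sets thus differ in exactly this element.
\<close>

lemma inv_sign_map:
  assumes w: "w \<in> signed_words A" and f: "\<And>z. \<bar>f z\<bar> = exchange \<bar>z\<bar>"
  shows "(inv_sign (map f w) :: 'a::comm_ring_1) = - inv_sign w"
proof -
  define I where "I u = {(i, j). 1 \<le> i \<and> i < j \<and> j \<le> length u \<and> letter u i > letter u j}"
    for u :: "int list"
  have fin: "finite (I u)" for u
    by (rule finite_subset[of _ "{..length u} \<times> {..length u}"]) (auto simp: I_def)
  define u where "u = map abs w"
  have u': "map abs (map f w) = map exchange u"
    using f by (simp add: u_def)
  have len: "length u = length w" by (simp add: u_def)
  have lu: "letter u i = \<bar>letter w i\<bar>" if "i \<le> length w" for i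
    unfolding u_def by (rule letter_map) (use that in auto)
  have lu': "letter (map exchange u) i = exchange (letter u i)" if "i \<le> length w" for i
    by (rule letter_map) (use that exchange_facts in \<open>auto simp: len\<close>)
  obtain p where p: "0 < p" "p \<le> length w" "\<bar>letter w p\<bar> = a"
    using ex_abs_letter[OF w aA] by blast
  obtain r where r: "0 < r" "r \<le> length w" "\<bar>letter w r\<bar> = b"
    using ex_abs_letter[OF w bA] by blast
  have pr: "p \<noteq> r" using p r a_less_b by auto
  \<comment> \<open>The one pair of positions whose comparison is reversed, in increasing order.\<close>
  define m M where "m = min p r" and "M = max p r"
  have mM: "1 \<le> m" "m < M" "M \<le> length w"
    using p r pr by (auto simp: m_def M_def)
  have same: "(i, j) \<in> I (map exchange u) \<longleftrightarrow> (i, j) \<in> I u" if ne: "(i, j) \<noteq> (m, M)" for i j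
  proof (cases "1 \<le> i \<and> i < j \<and> j \<le> length w")
    case True
    have "\<not> like_pair (letter u i) (letter u j)"
    proof
      assume "like_pair (letter u i) (letter u j)"
      then have "\<bar>letter w i\<bar> = a \<and> \<bar>letter w j\<bar> = b \<or> \<bar>letter w i\<bar> = b \<and> \<bar>letter w j\<bar> = a"
        using True by (auto simp: lu doubleton_eq_iff)
      then have "i = p \<and> j = r \<or> i = r \<and> j = p"
        using True p r abs_letter_eq_iff[OF w] by (metis less_le_trans less_imp_le_nat
          less_one not_le zero_less_one)
      then show False using ne True by (auto simp: m_def M_def)
    qed
    moreover have "\<bar>letter u i\<bar> \<in> A" "\<bar>letter u j\<bar> \<in> A"
      using True abs_letter_in[OF w] by (auto simp: lu)
    ultimately have "exchange (letter u j) < exchange (letter u i) \<longleftrightarrow> letter u j < letter u i"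
      by (intro exchange_less_iff) auto
    then show ?thesis using True by (auto simp: I_def lu' len)
  qed (auto simp: I_def len)
  have one: "(m, M) \<in> I (map exchange u) \<longleftrightarrow> (m, M) \<notin> I u"
  proof -
    have "letter u m = a \<and> letter u M = b \<or> letter u m = b \<and> letter u M = a"
      using p r by (auto simp: m_def M_def lu min_def max_def)
    moreover have "exchange a = b" "exchange b = a"
      using a_pos a_less_b by (auto simp: exchange_def)
    moreover have "m \<le> length w" using mM by simp
    ultimately show ?thesis
      using mM a_less_b by (auto simp: I_def lu' len simp del: letter_Suc)
  qed
  have step: "card K = Suc (card L)" if "(m, M) \<in> K" "(m, M) \<notin> L" "finite K"
    "\<And>i j. (i, j) \<noteq> (m, M) \<Longrightarrow> (i, j) \<in> K \<longleftrightarrow> (i, j) \<in> L" for K L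
  proof -
    have "K = insert (m, M) L"
    proof (rule set_eqI)
      fix z show "z \<in> K \<longleftrightarrow> z \<in> insert (m, M) L"
        using that(1) that(4)[of "fst z" "snd z"] by (cases "z = (m, M)") auto
    qed
    then show ?thesis using that by simp
  qed
  have "card (I (map exchange u)) = Suc (card (I u)) \<or> card (I u) = Suc (card (I (map exchange u)))"
    using step[of "I u" "I (map exchange u)"] step[of "I (map exchange u)" "I u"] one same fin
    by blast
  then have "(- 1 :: 'a) ^ card (I (map exchange u)) = - ((- 1) ^ card (I u))"
    by auto
  then show ?thesis
    unfolding inv_sign_def inv_word_def u' I_def u_def by simp
qed

text \<open>
  Reindexing along the involution negates every summand, hence the sum. Characteristic 0 and the
  absence of zero divisors allow the conclusion from \<open>S = - S\<close> to \<open>S = 0\<close>.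
\<close>

lemma sum_eq_0_by_letter_involution:
  fixes x :: "nat \<Rightarrow> 'a::{idom, ring_char_0}"
  assumes M: "M \<subseteq> signed_words A" and closed: "\<And>w. w \<in> M \<Longrightarrow> map f w \<in> M"
    and f: "\<And>z. \<bar>f z\<bar> = exchange \<bar>z\<bar>" and inv: "\<And>z. f (f z) = z"
    and weight: "\<And>w. w \<in> M \<Longrightarrow> descent_weight x (map f w) = descent_weight x w"
  shows "(\<Sum>w\<in>M. inv_sign w * descent_weight x w) = 0" (is "?S = 0")
proof -
  have ff: "map f (map f w) = w" for w
    using inv by (simp add: o_def)
  have "?S = (\<Sum>w\<in>M. - (inv_sign w * descent_weight x w))"
  proof (rule sum.reindex_bij_witness[of _ "map f" "map f"])
    fix w assume w: "w \<in> M"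
    show "- (inv_sign (map f w) * descent_weight x (map f w)) = inv_sign w * descent_weight x w"
      using inv_sign_map[OF subsetD[OF M w] f, where 'a = 'a] weight[OF w] by simp
  qed (use closed ff in auto)
  then have "?S = - ?S" by (simp add: sum_negf)
  then have "?S + ?S = 0" by (metis add.left_inverse)
  then show ?thesis by (metis mult_2 mult_eq_0_iff zero_neq_numeral)
qed

definition like_at :: "int list \<Rightarrow> nat \<Rightarrow> bool" where
  "like_at w i \<longleftrightarrow> 0 < i \<and> i < length w \<and> like_pair (letter w i) (letter w (Suc i))"

text \<open>
  The involution \<open>exchange\<close> keeps signs and the positions of \<open>a\<close> and \<open>b\<close>, so it cannot create the
  exceptional configuration.
\<close>

lemma sum_no_like_pair:
  fixes x :: "nat \<Rightarrow> 'a::{idom, ring_char_0}"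
  shows "(\<Sum>w\<in>{w \<in> signed_words A. \<forall>i. \<not> like_at w i}. inv_sign w * descent_weight x w) = 0"
proof (rule sum_eq_0_by_letter_involution[where f = exchange])
  fix w assume "w \<in> {w \<in> signed_words A. \<forall>i. \<not> like_at w i}"
  then have w: "w \<in> signed_words A" and nl: "\<And>i. \<not> like_at w i" by auto
  have "\<not> like_at (map exchange w) i" for i
    using nl[of i]
    by (simp add: like_at_def letter_map[of exchange, OF exchange_facts(1)] exchange_facts(3,4)
        exchange_in_pair del: letter_Suc cong: conj_cong)
  then show "map exchange w \<in> {w \<in> signed_words A. \<forall>i. \<not> like_at w i}"
    using map_signed_words[OF w exchange_facts(3)] by blast
  show "descent_weight x (map exchange w) = descent_weight x w"
  proof (rule descent_weight_map)
    fix i assume i: "i < length w"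
    show "exchange (letter w (Suc i)) < exchange (letter w i) \<longleftrightarrow> letter w (Suc i) < letter w i"
    proof (rule exchange_less_iff)
      show "letter w i = 0 \<or> \<bar>letter w i\<bar> \<in> A"
        using abs_letter_in[OF w, of i] i by (cases "i = 0") auto
      show "letter w (Suc i) = 0 \<or> \<bar>letter w (Suc i)\<bar> \<in> A"
        using abs_letter_in[OF w, of "Suc i"] i by (auto simp del: letter_Suc)
      show "\<not> like_pair (letter w i) (letter w (Suc i))"
      proof (cases "i = 0")
        case True
        then show ?thesis using a_pos a_less_b by (auto simp: doubleton_eq_iff)
      next
        case False
        then show ?thesis using nl[of i] i unfolding like_at_def by blast
      qed
    qed
  qed (rule exchange_facts)
qed (simp_all add: exchange_facts)

text \<open>
  Under \<open>neg_exchange\<close> both letters of the pair change their signs. The condition \<open>i > 1\<close> keeps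
  them away from \<open>\<pi>\<^sub>0 = 0\<close>, the only letter for which this would matter.
\<close>

lemma sum_later_like_pair:
  fixes x :: "nat \<Rightarrow> 'a::{idom, ring_char_0}"
  shows "(\<Sum>w\<in>{w \<in> signed_words A. \<exists>i>1. like_at w i}. inv_sign w * descent_weight x w) = 0"
proof (rule sum_eq_0_by_letter_involution[where f = neg_exchange])
  fix w assume "w \<in> {w \<in> signed_words A. \<exists>i>1. like_at w i}"
  then obtain i where w: "w \<in> signed_words A" and i: "i > 1" "like_at w i" by auto
  have i': "i < length w" "like_pair (letter w i) (letter w (Suc i))"
    using i by (auto simp: like_at_def)
  have "sgn (neg_exchange z) = - sgn z" if "\<bar>z\<bar> \<in> {a, b}" for z
    using that a_pos a_less_b by (auto simp: neg_exchange_def sgn_mult)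
  moreover have in_pair: "\<bar>letter w i\<bar> \<in> {a, b}" "\<bar>letter w (Suc i)\<bar> \<in> {a, b}"
    using i'(2) by blast+
  ultimately have "like_pair (neg_exchange (letter w i)) (neg_exchange (letter w (Suc i)))"
    using i'(2) by (simp only: neg_exchange_facts(3) exchange_in_pair)
  then have "like_at (map neg_exchange w) i"
    using i i'(1) letter_map[of neg_exchange, OF neg_exchange_facts(1), of _ w]
    by (simp add: like_at_def del: letter_Suc)
  then show "map neg_exchange w \<in> {w \<in> signed_words A. \<exists>i>1. like_at w i}"
    using map_signed_words[OF w neg_exchange_facts(3)] i(1) by blast
  \<comment> \<open>Absolute values do not repeat, so \<open>a\<close> and \<open>b\<close> occur only in the pair at \<open>i\<close>.\<close>
  have pos: "k = i \<or> k = Suc i" if "0 < k" "k \<le> length w" "\<bar>letter w k\<bar> \<in> {a, b}" for k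
  proof -
    have "\<bar>letter w k\<bar> = \<bar>letter w i\<bar> \<or> \<bar>letter w k\<bar> = \<bar>letter w (Suc i)\<bar>"
      using that i'(2) by (auto simp: doubleton_eq_iff simp del: letter_Suc)
    then show ?thesis
      using abs_letter_eq_iff[OF w that(1,2), of i] abs_letter_eq_iff[OF w that(1,2), of "Suc i"]
        i(1) i'(1) by (auto simp del: letter_Suc)
  qed
  show "descent_weight x (map neg_exchange w) = descent_weight x w"
  proof (rule descent_weight_map)
    fix k assume k: "k < length w"
    show "neg_exchange (letter w (Suc k)) < neg_exchange (letter w k)
      \<longleftrightarrow> letter w (Suc k) < letter w k"
    proof (cases "k = 0")
      case True
      have "\<bar>letter w (Suc k)\<bar> \<notin> {a, b}"
        using pos[of "Suc k"] True k i(1) by (auto simp del: letter_Suc)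
      then show ?thesis
        using True by (simp add: neg_exchange_def)
    next
      case False
      show ?thesis
      proof (rule neg_exchange_less_iff)
        show "\<bar>letter w k\<bar> \<in> A" "\<bar>letter w (Suc k)\<bar> \<in> A"
          using abs_letter_in[OF w] False k by (auto simp del: letter_Suc)
        show "\<bar>letter w k\<bar> \<noteq> \<bar>letter w (Suc k)\<bar>"
          using abs_letter_eq_iff[OF w, of k "Suc k"] False k by (auto simp del: letter_Suc)
        assume "{\<bar>letter w k\<bar>, \<bar>letter w (Suc k)\<bar>} = {a, b}"
        then have "\<bar>letter w k\<bar> \<in> {a, b}" "\<bar>letter w (Suc k)\<bar> \<in> {a, b}" by blast+
        then have "k = i"
          using pos[of k] pos[of "Suc k"] False k by auto
        then show "sgn (letter w k) = sgn (letter w (Suc k))" using i'(2) by simp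
      qed
    qed
  qed (rule neg_exchange_facts)
qed (simp_all add: neg_exchange_facts)

section \<open>Words beginning with the two smallest letters\<close>

text \<open>
  All further absolute values are larger than \<open>b\<close>, so the only inversion that involves the first
  two positions is the one between them.
\<close>

lemma inv_sign_Cons_Cons:
  assumes v: "v \<in> signed_words (A - {a, b})" and cd: "{\<bar>c\<bar>, \<bar>d\<bar>} = {a, b}"
  shows "(inv_sign (c # d # v) :: 'a::comm_ring_1) = (if \<bar>c\<bar> > \<bar>d\<bar> then - 1 else 1) * inv_sign v"
proof -
  define I where "I u = {(i, j). 1 \<le> i \<and> i < j \<and> j \<le> length u \<and> letter u i > letter u j}"
    for u :: "int list"
  define u where "u = map abs v"
  have fin: "finite (I u)" for u
    by (rule finite_subset[of _ "{..length u} \<times> {..length u}"]) (auto simp: I_def)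
  \<comment> \<open>Positions in \<open>v\<close> are shifted by 2 in \<open>c # d # v\<close>.\<close>
  define s :: "nat \<times> nat \<Rightarrow> nat \<times> nat" where "s = (\<lambda>(i, j). (i + 2, j + 2))"
  have inj: "inj_on s X" for X by (auto simp: s_def inj_on_def)
  have big: "b < letter u k" if "0 < k" "k \<le> length v" for k
    using abs_letter_in[OF v that] others that letter_map[of abs k v] by (auto simp: u_def)
  have cdb: "\<bar>c\<bar> \<le> b" "\<bar>d\<bar> \<le> b" using cd a_less_b by (auto simp: doubleton_eq_iff)
  have I_eq: "I (\<bar>c\<bar> # \<bar>d\<bar> # u) = (if \<bar>c\<bar> > \<bar>d\<bar> then {(1, 2)} else {}) \<union> s ` I u" (is "?L = ?R")
  proof (rule set_eqI, clarify)
    fix i j :: nat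
    \<comment> \<open>Not an admissible pair; inside the first two; from these into \<open>v\<close>; inside \<open>v\<close>.\<close>
    consider "i = 0" | "j \<le> i" | "i = 1" "j = 2" | k where "i \<in> {1, 2}" "j = k + 2" "0 < k"
      | k l where "i = k + 2" "j = l + 2" "0 < k" "0 < l" "k < l"
    proof (cases "i = 0 \<or> j \<le> i \<or> i = 1 \<and> j = 2")
      case False
      then have j: "j = (j - 2) + 2" "0 < j - 2" by auto
      show ?thesis
      proof (cases "i \<le> 2")
        case True
        then show ?thesis using that(4)[OF _ j] False by fastforce
      next
        case i: False
        then have "i = (i - 2) + 2" "0 < i - 2" "i - 2 < j - 2" using False by auto
        then show ?thesis using that(5)[OF _ j(1) _ j(2)] by blast
      qed
    qed (use that in blast)
    then show "(i, j) \<in> ?L \<longleftrightarrow> (i, j) \<in> ?R"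
    proof cases
      case 4
      have "\<not> letter u k < \<bar>c\<bar>" "\<not> letter u k < \<bar>d\<bar>" if "k \<le> length v"
        using big[OF \<open>0 < k\<close> that] cdb by auto
      then show ?thesis using 4 
        by (auto simp: I_def s_def u_def numeral_2_eq_2 letter_def)
    next
      case 5
      have "(i, j) \<in> s ` I u \<longleftrightarrow> (k, l) \<in> I u" using 5 by (force simp: s_def)
      moreover have "letter (y # z # u) (k + 2) = letter u k" "letter (y # z # u) (l + 2) = letter u l"
        for y z using 5 by (simp_all del: letter_Suc)
      ultimately show ?thesis using 5 by (auto simp: I_def simp del: letter_Suc)
    qed (auto simp: I_def s_def numeral_2_eq_2)
  qed
  have "card (I (\<bar>c\<bar> # \<bar>d\<bar> # u)) = (if \<bar>c\<bar> > \<bar>d\<bar> then 1 else 0) + card (I u)"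
  proof -
    have "(1, 2) \<notin> s ` I u" by (auto simp: s_def)
    then show ?thesis
      using I_eq fin inj by (simp add: card_image)
  qed
  then show ?thesis
    unfolding inv_sign_def inv_word_def I_def u_def by simp
qed

text \<open>
  The first letter of \<open>v\<close> exceeds both \<open>c\<close> and \<open>d\<close> in absolute value, so it is smaller than \<open>d\<close>
  exactly when it is negative. Hence a descent at position 2 of the long word is a descent of \<open>v\<close>
  at position 0.
\<close>

lemma descent_weight_Cons_Cons:
  assumes v: "v \<in> signed_words (A - {a, b})" and cd: "\<bar>c\<bar> \<le> b" "\<bar>d\<bar> \<le> b"
  shows "descent_weight x (c # d # v) =
    (if c < 0 then x 0 else 1) * (if d < c then x 1 else 1) * descent_weight (\<lambda>i. x (i + 2)) v"
proof -
  have "v ! i < (d # v) ! i \<longleftrightarrow> v ! i < letter v i" if "i < length v" for i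
  proof (cases i)
    case 0
    have "b < \<bar>v ! 0\<bar>"
      using abs_letter_in[OF v, of 1] others that 0 by auto
    then show ?thesis using 0 cd by auto
  qed auto
  then have "(\<Prod>i<length v. if v ! i < (d # v) ! i then x (Suc (Suc i)) else 1) =
      descent_weight (\<lambda>i. x (i + 2)) v"
    unfolding descent_weight_def by (intro prod.cong) auto
  then show ?thesis
    unfolding descent_weight_def[of x]
    by (simp add: prod.lessThan_Suc_shift mult.assoc del: prod.lessThan_Suc)
qed

lemma sum_initial_like_pair:
  fixes x :: "nat \<Rightarrow> 'a::comm_ring_1"
  shows "(\<Sum>w\<in>{w \<in> signed_words A. like_at w 1}. inv_sign w * descent_weight x w) =
    (1 - x 0) * (1 - x 1) *
    (\<Sum>v\<in>signed_words (A - {a, b}). inv_sign v * descent_weight (\<lambda>i. x (i + 2)) v)"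
proof -
  define P where "P = {(a, b), (b, a), (- a, - b), (- b, - a)}"
  define h :: "(int \<times> int) \<times> int list \<Rightarrow> int list" where "h = (\<lambda>((c, d), v). c # d # v)"
  have P_iff: "(c, d) \<in> P \<longleftrightarrow> like_pair c d" for c d
    using a_pos a_less_b by (auto simp: P_def doubleton_eq_iff sgn_if abs_if split: if_splits)
  have "{w \<in> signed_words A. like_at w 1} = h ` (P \<times> signed_words (A - {a, b}))"
  proof (intro equalityI subsetI)
    fix w assume "w \<in> {w \<in> signed_words A. like_at w 1}"
    then have w: "w \<in> signed_words A" and "like_at w 1" by auto
    then obtain c d v where cdv: "w = c # d # v" "like_pair c d"
      by (auto simp: like_at_def neq_Nil_conv less_Suc_eq_le Suc_le_length_iff
          dest!: Suc_leI simp: numeral_2_eq_2)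
    have "v \<in> signed_words (A - {a, b})"
      using w cdv by (auto simp: signed_words_iff doubleton_eq_iff)
    then show "w \<in> h ` (P \<times> signed_words (A - {a, b}))"
      using cdv P_iff by (intro image_eqI[of _ _ "((c, d), v)"]) (simp_all add: h_def)
  next
    fix w assume "w \<in> h ` (P \<times> signed_words (A - {a, b}))"
    then obtain c d v where *: "w = c # d # v" "(c, d) \<in> P" "v \<in> signed_words (A - {a, b})"
      by (auto simp: h_def)
    then have cd: "{\<bar>c\<bar>, \<bar>d\<bar>} = {a, b}" "sgn c = sgn d" using P_iff by blast+
    then have "like_at w 1" using *(1) by (simp add: like_at_def)
    moreover have "abs ` set w = {\<bar>c\<bar>, \<bar>d\<bar>} \<union> abs ` set v" using *(1) by auto
    then have "abs ` set w = A" using *(3) aA bA cd by (auto simp: signed_words_iff)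
    moreover have "\<bar>c\<bar> \<noteq> \<bar>d\<bar>" "\<bar>c\<bar> \<in> {a, b}" "\<bar>d\<bar> \<in> {a, b}"
      using cd a_less_b by (auto simp: doubleton_eq_iff)
    then have "distinct (map abs w)"
      using *(1,3) by (auto simp: signed_words_iff)
    ultimately show "w \<in> {w \<in> signed_words A. like_at w 1}"
      by (simp add: signed_words_iff)
  qed
  moreover have "inj_on h (P \<times> signed_words (A - {a, b}))"
    by (auto simp: h_def inj_on_def)
  ultimately have "(\<Sum>w\<in>{w \<in> signed_words A. like_at w 1}. inv_sign w * descent_weight x w) =
    (\<Sum>p\<in>P. \<Sum>v\<in>signed_words (A - {a, b}). inv_sign (h (p, v)) * descent_weight x (h (p, v)))"
    by (simp add: sum.reindex sum.cartesian_product)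
  also have "\<dots> = (\<Sum>p\<in>P. (if \<bar>fst p\<bar> > \<bar>snd p\<bar> then - 1 else 1) *
      ((if fst p < 0 then x 0 else 1) * (if snd p < fst p then x 1 else 1)) *
      (\<Sum>v\<in>signed_words (A - {a, b}). inv_sign v * descent_weight (\<lambda>i. x (i + 2)) v))"
  proof (rule sum.cong)
    fix p assume p: "p \<in> P"
    obtain c d where cd: "p = (c, d)" by force
    have cd': "{\<bar>c\<bar>, \<bar>d\<bar>} = {a, b}" "\<bar>c\<bar> \<le> b" "\<bar>d\<bar> \<le> b"
      using p cd a_pos a_less_b by (auto simp: P_def)
    show "(\<Sum>v\<in>signed_words (A - {a, b}). inv_sign (h (p, v)) * descent_weight x (h (p, v))) =
      (if \<bar>fst p\<bar> > \<bar>snd p\<bar> then - 1 else 1) *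
      ((if fst p < 0 then x 0 else 1) * (if snd p < fst p then x 1 else 1)) *
      (\<Sum>v\<in>signed_words (A - {a, b}). inv_sign v * descent_weight (\<lambda>i. x (i + 2)) v)"
      unfolding sum_distrib_left
      by (rule sum.cong)
        (simp_all add: h_def cd inv_sign_Cons_Cons[OF _ cd'(1)]
          descent_weight_Cons_Cons[OF _ cd'(2,3)] mult.assoc mult.left_commute)
  qed simp
  also have "\<dots> = (1 - x 0) * (1 - x 1) *
      (\<Sum>v\<in>signed_words (A - {a, b}). inv_sign v * descent_weight (\<lambda>i. x (i + 2)) v)"
    unfolding sum_distrib_right[symmetric]
    using a_pos a_less_b by (simp add: P_def algebra_simps)
  finally show ?thesis .
qed

lemma sum_signed_words_step:
  fixes x :: "nat \<Rightarrow> 'a::{idom, ring_char_0}"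
  shows "(\<Sum>w\<in>signed_words A. inv_sign w * descent_weight x w) =
    (1 - x 0) * (1 - x 1) *
    (\<Sum>v\<in>signed_words (A - {a, b}). inv_sign v * descent_weight (\<lambda>i. x (i + 2)) v)"
proof -
  let ?N = "{w \<in> signed_words A. \<forall>i. \<not> like_at w i}"
  let ?L = "{w \<in> signed_words A. \<exists>i>1. like_at w i}"
  let ?I = "{w \<in> signed_words A. like_at w 1}"
  have "\<not> like_at w i" if w: "w \<in> signed_words A" and 1: "like_at w 1" and i: "i > 1" for w i
  proof
    assume L: "like_at w i"
    have "\<bar>letter w (Suc i)\<bar> = \<bar>letter w 1\<bar> \<or> \<bar>letter w (Suc i)\<bar> = \<bar>letter w 2\<bar>"
      using L 1 by (auto simp: like_at_def doubleton_eq_iff numeral_2_eq_2 simp del: letter_Suc)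
    then show False
      using L 1 i abs_letter_eq_iff[OF w, of "Suc i" 1] abs_letter_eq_iff[OF w, of "Suc i" 2]
      by (auto simp: like_at_def simp del: letter_Suc)
  qed
  then have disj: "?L \<inter> ?I = {}" "?N \<inter> (?L \<union> ?I) = {}" by auto
  have "signed_words A = ?N \<union> (?L \<union> ?I)"
  proof -
    have "i = 1 \<or> i > 1" if "like_at w i" for w i
      using that by (auto simp: like_at_def)
    then show ?thesis by blast
  qed
  then have "(\<Sum>w\<in>signed_words A. inv_sign w * descent_weight x w) =
      (\<Sum>w\<in>?N \<union> (?L \<union> ?I). inv_sign w * descent_weight x w)" by simp
  also have "\<dots> = (\<Sum>w\<in>?I. inv_sign w * descent_weight x w)"
    using finite_signed_words[OF finite_A] disj
    by (simp add: sum.union_disjoint sum_no_like_pair sum_later_like_pair del: One_nat_def)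
  finally show ?thesis by (simp only: sum_initial_like_pair)
qed

end

section \<open>The signed descent enumerator\<close>

lemma inv_word_eq_0:
  assumes "length u \<le> 1"
  shows "inv_word u = 0"
proof -
  have "{(i, j). 1 \<le> i \<and> i < j \<and> j \<le> length u \<and> letter u i > letter u j} = {}"
    using assms by auto
  then show ?thesis by (simp only: inv_word_def card.empty)
qed

text \<open>
  The parity in the last factor records which of the two base cases the induction in steps of two
  ends in: \<open>F\<^sub>0 = 1\<close> leaves only factors \<open>1 - x\<^sub>i\<close>, while \<open>F\<^sub>1\<close> leaves \<open>1 + x\<^sub>n\<^sub>-\<^sub>1\<close>.
\<close>

theorem sum_signed_words:
  fixes x :: "nat \<Rightarrow> 'a::{idom, ring_char_0}"
  assumes "finite A" "\<And>z. z \<in> A \<Longrightarrow> 0 < z" "card A = n"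
  shows "(\<Sum>w\<in>signed_words A. inv_sign w * descent_weight x w) =
    (\<Prod>i<n. if Suc i = n \<and> odd n then 1 + x i else 1 - x i)"
  using assms
proof (induction n arbitrary: A x rule: induct_nat_012)
  case 0
  then have "signed_words A = {[]}" by (auto simp: signed_words_iff)
  then show ?case by (simp add: inv_sign_def descent_weight_def inv_word_eq_0)
next
  case 1
  then obtain a where A: "A = {a}" by (metis One_nat_def card_1_singletonE)
  have a: "0 < a" using 1 A by simp
  have "signed_words A = {[a], [- a]}"
  proof (intro equalityI subsetI)
    fix w assume w: "w \<in> signed_words A"
    then have "length w = 1"
      using distinct_card[of "map abs w"] A by (simp add: signed_words_iff)
    then obtain y where "w = [y]" by (auto simp: length_Suc_conv)
    then show "w \<in> {[a], [- a]}" using w A by (auto simp: signed_words_iff)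
  qed (use A a in \<open>auto simp: signed_words_iff\<close>)
  moreover have "[a] \<noteq> [- a]" using a by simp
  ultimately show ?case
    using a by (simp add: inv_sign_def descent_weight_def inv_word_eq_0)
next
  case (ge2 n)
  define a b where "a = Min A" and "b = Min (A - {a})"
  have ne: "A \<noteq> {}" using ge2.prems by auto
  have a: "a \<in> A" "\<And>z. z \<in> A \<Longrightarrow> a \<le> z"
    using ne ge2.prems by (auto simp: a_def)
  have "card (A - {a}) = Suc n" using ge2.prems a by simp
  then have "A - {a} \<noteq> {}" by (metis card.empty nat.distinct(1))
  then have b: "b \<in> A - {a}" "\<And>z. z \<in> A - {a} \<Longrightarrow> b \<le> z"
    using ge2.prems Min_in[of "A - {a}"] Min_le[of "A - {a}"] by (auto simp: b_def)
  interpret two_smallest A a b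
  proof
    show "a < b" using a b by (metis Diff_iff insertI1 order_less_le)
    show "z = a \<or> z = b \<or> b < z" if "z \<in> A" for z
      using b(2)[of z] that by auto
  qed (use ge2.prems a b in auto)
  have "card (A - {a, b}) = n"
    using ge2.prems a b by (simp add: card_Diff_subset)
  then have "(\<Sum>v\<in>signed_words (A - {a, b}). inv_sign v * descent_weight (\<lambda>i. x (i + 2)) v) =
      (\<Prod>i<n. if Suc i = n \<and> odd n then 1 + x (i + 2) else 1 - x (i + 2))"
    using ge2.prems by (intro ge2.IH(1)) auto
  moreover have "(\<Prod>i<Suc (Suc n).
        if Suc i = Suc (Suc n) \<and> odd (Suc (Suc n)) then 1 + x i else 1 - x i) =
      (1 - x 0) * (1 - x 1) *
      (\<Prod>i<n. if Suc i = n \<and> odd n then 1 + x (i + 2) else 1 - x (i + 2))"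
  proof -
    have "\<not> (Suc 1 = Suc (Suc n) \<and> odd (Suc (Suc n)))" by (auto intro: odd_pos)
    then show ?thesis
      unfolding prod.lessThan_Suc_shift mult.assoc
      by (intro arg_cong2[of _ _ _ _ "(*)"] prod.cong) auto
  qed
  ultimately show ?case
    by (simp only: sum_signed_words_step)
qed

lemma descent_weight_des_B_maj_B:
  fixes t q :: "'a::comm_ring_1"
  shows "descent_weight (\<lambda>i. t * q ^ i) w = t ^ des_B w * q ^ maj_B w"
proof -
  have "descent_weight (\<lambda>i. t * q ^ i) w = (\<Prod>i\<in>Des_B w. t * q ^ i)"
    unfolding descent_weight_def Des_B_def
    by (simp add: prod.If_cases Collect_conj_eq lessThan_def)
  then show ?thesis
    by (simp add: prod.distrib des_B_def maj_B_def power_sum)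
qed

theorem theorem5p2:
  fixes n :: nat
  assumes "n \<ge> 1"
  shows "(\<Sum>\<pi>\<in>signed_perms n.
            (- 1) ^ inv_word (map abs \<pi>) * var_t ^ des_B \<pi> * var_q ^ maj_B \<pi>) =
         (1 + (- 1) ^ (n - 1) * var_t * var_q ^ (n - 1)) *
         (\<Prod>i<n - 1. 1 - var_t * var_q ^ i)"
proof -
  obtain m where n: "n = Suc m" using assms by (cases n) auto
  have "(\<Sum>\<pi>\<in>signed_perms n.
            (- 1) ^ inv_word (map abs \<pi>) * var_t ^ des_B \<pi> * var_q ^ maj_B \<pi>) =
    (\<Sum>w\<in>signed_words {1..int n}. inv_sign w * descent_weight (\<lambda>i. var_t * var_q ^ i) w)"
    unfolding descent_weight_des_B_maj_B inv_sign_def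
    by (simp add: signed_perms_def signed_words_def mult.assoc)
  also have "\<dots> = (\<Prod>i<n. if Suc i = n \<and> odd n then 1 + var_t * var_q ^ i
      else 1 - var_t * var_q ^ i)"
    by (rule sum_signed_words) auto
  also have "\<dots> = (1 + (- 1) ^ m * var_t * var_q ^ m) * (\<Prod>i<m. 1 - var_t * var_q ^ i)"
    unfolding n prod.lessThan_Suc
    by (cases "even m") (auto simp: mult.commute intro!: prod.cong)
  finally show ?thesis by (simp add: n)
qed

end
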